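(* Let $b,q$ be nonzero complex numbers. For nonzero complex $a,c$ and an integer $n\ge1$ define $$G_n(a,c):=\sum_{k=0}^{n-1}\frac{(aq^{4k}-1)q^k}{1-a}\,\frac{(a,b;q)_k}{(aq/c,cq/(ab);q)_k}\,\frac{(c,a^2b/c;q^3)_k}{(q^3,q^3a/b;q^3)_k}\,\frac{(q/b;q)_{2k}}{(ab;q)_{2k}} .$$ Then, provided no denominator below (including those in the sums) vanishes, $$G_n(a,c)=\frac{(1-ab^2)(aq;q)_3}{(ab;q)_3(1-q^3a/b)}\,G_n(aq^3,cq^3)$$ $$+\frac{ab}{(1-a)(1-ab)}\,\frac{(a,b;q)_n}{(qa/c,qc/(ab);q)_{n-1}}\,\frac{(q^3c,q^3a^2b/c;q^3)_{n-1}}{(q^3,q^3a^2b;q^3)_{n-1}}\,\frac{(q/b;q)_{2n}}{(qab;q)_{2n}}\,\frac{(q^3a^2b;q^3)_n}{(q^3a/b;q^3)_n}.$$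
   Context: For an integer $m\ge 0$, $(a;q)_m=\prod_{j=0}^{m-1}(1-aq^j)$ and $(a_1,\dots,a_r;q)_m=\prod_{i=1}^r(a_i;q)_m$. *)

theory Defs
  imports Complex_Main
begin

definition qpoch :: "complex \<Rightarrow> complex \<Rightarrow> nat \<Rightarrow> complex" where
  "qpoch a q m = (\<Prod>j<m. 1 - a * q ^ j)"

definition qpochs :: "complex list \<Rightarrow> complex \<Rightarrow> nat \<Rightarrow> complex" where
  "qpochs as q m = (\<Prod>a\<leftarrow>as. qpoch a q m)"

definition G :: "complex \<Rightarrow> complex \<Rightarrow> nat \<Rightarrow> complex \<Rightarrow> complex \<Rightarrow> complex" where
  "G b q n a c =
    (\<Sum>k<n. (a * q ^ (4 * k) - 1) * q ^ k / (1 - a)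
      * (qpochs [a, b] q k / qpochs [a * q / c, c * q / (a * b)] q k)
      * (qpochs [c, a\<^sup>2 * b / c] (q ^ 3) k / qpochs [q ^ 3, q ^ 3 * a / b] (q ^ 3) k)
      * (qpoch (q / b) q (2 * k) / qpoch (a * b) q (2 * k)))"

(* No denominator in the sum G b q n a c vanishes, apart from c and a * b inside the parameters. *)
definition G_denoms_nonzero :: "complex \<Rightarrow> complex \<Rightarrow> nat \<Rightarrow> complex \<Rightarrow> complex \<Rightarrow> bool" where
  "G_denoms_nonzero b q n a c \<longleftrightarrow>
    1 - a \<noteq> 0 \<and>
    (\<forall>k<n. qpochs [a * q / c, c * q / (a * b)] q k \<noteq> 0 \<and>
           qpochs [q ^ 3, q ^ 3 * a / b] (q ^ 3) k \<noteq> 0 \<and>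
           qpoch (a * b) q (2 * k) \<noteq> 0)"

end

theory Submission
  imports Defs
begin

text \<open>
  Write \<open>t\<^sub>k\<close>, \<open>t'\<^sub>k\<close> for the summands of \<open>G\<^sub>n(a,c)\<close> and \<open>G\<^sub>n(aq\<^sup>3,cq\<^sup>3)\<close>, \<open>K\<close> for the
  factor in front of the latter and \<open>R\<^sub>n\<close> for the boundary term. The claim telescopes:
  \<open>t\<^sub>n - K t'\<^sub>n = R\<^bsub>n+1\<^esub> - R\<^sub>n\<close> and \<open>t\<^sub>0 - K t'\<^sub>0 = R\<^sub>1\<close>. All four terms are multiples
  of one common product of q-shifted factorials, and after cancelling it a polynomial identity in
  \<open>a\<close>, \<open>b\<close>, \<open>c\<close>, \<open>q\<close> and \<open>Q = q\<^sup>n\<close> remains.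
\<close>

section \<open>The polynomial identity in \<open>a\<close>, \<open>b\<close>, \<open>c\<close>,
  \<open>q\<close> and \<open>Q\<close>\<close>

lemma contiguous_poly:
  fixes a b c q Q :: complex
  shows "(1-c)*(c-a^2*b)*((a*Q^4-1)*Q*(b-q^3*a*Q^3)*(1-a*b*Q^2)*(1-a*b*q*Q^2)*(1-a*b*q^2*Q^2))
    - (1-c*Q^3)*(c-a^2*b*Q^3)
      * (b*(1-a*b^2)*(a*q^3*Q^4-1)*Q*(1-a*Q)*(1-a*q*Q)*(1-a*q^2*Q))
    = (1-c*Q^3)*(c-a^2*b*Q^3)
      * (a*(1-a*Q)*(1-b*Q)*(b-q*Q^2)*(b-q^2*Q^2)*(1-a^2*b*q^3*Q^3))
    - (c-a*Q)*(a*b-c*Q)*((1-Q^3)*(b-q^3*a*Q^3)*(1-a*b*q*Q^2)*(1-a*b*q^2*Q^2)*(1-a^2*b*Q^3))"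
proof -
  define A1 where "A1 = (a*Q^4-1)*Q*(b-q^3*a*Q^3)*(1-a*b*Q^2)*(1-a*b*q*Q^2)*(1-a*b*q^2*Q^2)"
  define A2 where "A2 = b*(1-a*b^2)*(a*q^3*Q^4-1)*Q*(1-a*Q)*(1-a*q*Q)*(1-a*q^2*Q)"
  define A3 where "A3 = a*(1-a*Q)*(1-b*Q)*(b-q*Q^2)*(b-q^2*Q^2)*(1-a^2*b*q^3*Q^3)"
  define A4 where "A4 = (1-Q^3)*(b-q^3*a*Q^3)*(1-a*b*q*Q^2)*(1-a*b*q^2*Q^2)*(1-a^2*b*Q^3)"
  \<comment> \<open>Each quadratic in \<open>c\<close> is a combination of \<open>c\<^sup>2 + a\<^sup>2 b\<close> and \<open>c\<close>;
    these are the two coefficients.\<close>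
  have "A1 - Q^3 * A2 = Q^3 * A3 - Q * A4"
    unfolding A1_def A2_def A3_def A4_def by algebra
  moreover have "(1+a^2*b) * A1 - (1+a^2*b*Q^6) * A2 = (1+a^2*b*Q^6) * A3 - (a*b+a*Q^2) * A4"
    unfolding A1_def A2_def A3_def A4_def by algebra
  ultimately have "(1-c)*(c-a^2*b) * A1 - (1-c*Q^3)*(c-a^2*b*Q^3) * A2
      = (1-c*Q^3)*(c-a^2*b*Q^3) * A3 - (c-a*Q)*(a*b-c*Q) * A4"
    by algebra
  then show ?thesis
    unfolding A1_def A2_def A3_def A4_def .
qed

text \<open>All four terms have the common denominator \<open>b*c\<close>, so this is
  \<open>contiguous_poly\<close> divided by \<open>b*c\<close>. The factors now have the form
  \<open>1 - x\<close> in which q-shifted factorials supply them.\<close>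

lemma contiguous_rat:
  fixes a b c q Q :: complex
  assumes "a \<noteq> 0" "b \<noteq> 0" "c \<noteq> 0"
  shows "(a*Q^4-1)*Q*(1-c)*(1-a^2*b/c)
      *(1-q^3*a/b*Q^3)*(1-a*b*Q^2)*(1-a*b*q*Q^2)*(1-a*b*q^2*Q^2)
    - (1-a*b^2)*(a*q^3*Q^4-1)*Q*(1-a*Q)*(1-a*q*Q)*(1-a*q^2*Q)*(1-c*Q^3)*(1-a^2*b/c*Q^3)
    = a*b*(1-a*Q)*(1-b*Q)*(1-c*Q^3)*(1-a^2*b/c*Q^3)
      *(1-q/b*Q^2)*(1-q^2/b*Q^2)*(1-a^2*b*q^3*Q^3)
    - a*b*(1-a*Q/c)*(1-c*Q/(a*b))*(1-Q^3)
      *(1-q^3*a/b*Q^3)*(1-a*b*q*Q^2)*(1-a*b*q^2*Q^2)*(1-a^2*b*Q^3)"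
    (is "?l = ?r")
proof -
  have e: "1-a^2*b/c = (c-a^2*b)/c" "1-a^2*b/c*Q^3 = (c-a^2*b*Q^3)/c"
    "1-q^3*a/b*Q^3 = (b-q^3*a*Q^3)/b" "1-q/b*Q^2 = (b-q*Q^2)/b" "1-q^2/b*Q^2 = (b-q^2*Q^2)/b"
    "1-a*Q/c = (c-a*Q)/c" "1-c*Q/(a*b) = (a*b-c*Q)/(a*b)"
    using assms by (simp_all add: divide_simps)
  have "b*c*?l = (1-c)*(c-a^2*b)*((a*Q^4-1)*Q*(b-q^3*a*Q^3)*(1-a*b*Q^2)*(1-a*b*q*Q^2)*(1-a*b*q^2*Q^2))
    - (1-c*Q^3)*(c-a^2*b*Q^3)
      * (b*(1-a*b^2)*(a*q^3*Q^4-1)*Q*(1-a*Q)*(1-a*q*Q)*(1-a*q^2*Q))"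
    unfolding e right_diff_distrib[of "b*c"]
    by (rule arg_cong2[where f = "(-)"]; use assms in \<open>simp add: mult_ac\<close>)
  also note contiguous_poly
  also have "(1-c*Q^3)*(c-a^2*b*Q^3)
      * (a*(1-a*Q)*(1-b*Q)*(b-q*Q^2)*(b-q^2*Q^2)*(1-a^2*b*q^3*Q^3))
    - (c-a*Q)*(a*b-c*Q)*((1-Q^3)*(b-q^3*a*Q^3)*(1-a*b*q*Q^2)*(1-a*b*q^2*Q^2)*(1-a^2*b*Q^3)) = b*c*?r"
    unfolding e right_diff_distrib[of "b*c"]
    by (rule arg_cong2[where f = "(-)"]; use assms in \<open>simp add: mult_ac\<close>)
  finally show ?thesis
    using assms by simp
qed

section \<open>Rules for q-shifted factorials\<close>

lemma qpoch_0 [simp]: "qpoch a q 0 = 1"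
  by (simp add: qpoch_def)

lemma qpoch_Suc: "qpoch a q (Suc m) = qpoch a q m * (1 - a * q ^ m)"
  by (simp add: qpoch_def)

lemma qpoch_add: "qpoch a q (m + k) = qpoch a q m * qpoch (a * q ^ m) q k"
  by (induction k) (simp_all add: qpoch_Suc power_add mult_ac)

lemma qpoch_Suc_left: "qpoch a q (Suc m) = (1 - a) * qpoch (a * q) q m"
  using qpoch_add[of a q 1 m] by (simp add: qpoch_Suc)

lemma qpoch_nonzero_mono:
  assumes "qpoch a q n \<noteq> 0" "m \<le> n"
  shows "qpoch a q m \<noteq> 0"
  using assms qpoch_add[of a q m "n - m"] by auto

lemma qpochs_pair [simp]: "qpochs [a, b] q m = qpoch a q m * qpoch b q m"
  by (simp add: qpochs_def)

section \<open>Summand, boundary term and prefactor of the telescoping\<close>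

definition G_summand :: "complex \<Rightarrow> complex \<Rightarrow> complex \<Rightarrow> complex \<Rightarrow> nat \<Rightarrow> complex" where
  "G_summand b q a c k = (a * q ^ (4 * k) - 1) * q ^ k / (1 - a)
      * (qpochs [a, b] q k / qpochs [a * q / c, c * q / (a * b)] q k)
      * (qpochs [c, a\<^sup>2 * b / c] (q ^ 3) k / qpochs [q ^ 3, q ^ 3 * a / b] (q ^ 3) k)
      * (qpoch (q / b) q (2 * k) / qpoch (a * b) q (2 * k))"

text \<open>This is \<open>R\<^sub>n\<close>, meant for \<open>n\<close> at least 1: at 0 the
  truncated \<open>n - 1\<close> gives \<open>a*b/((1-a)*(1-a*b))\<close> rather than 0, so the
  telescoping has to start at 1.\<close>

definition G_boundary :: "complex \<Rightarrow> complex \<Rightarrow> complex \<Rightarrow> complex \<Rightarrow> nat \<Rightarrow> complex" where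
  "G_boundary b q a c n = a * b / ((1 - a) * (1 - a * b))
        * (qpochs [a, b] q n / qpochs [q * a / c, q * c / (a * b)] q (n - 1))
        * (qpochs [q ^ 3 * c, q ^ 3 * a\<^sup>2 * b / c] (q ^ 3) (n - 1)
            / qpochs [q ^ 3, q ^ 3 * a\<^sup>2 * b] (q ^ 3) (n - 1))
        * (qpoch (q / b) q (2 * n) / qpoch (q * a * b) q (2 * n))
        * (qpoch (q ^ 3 * a\<^sup>2 * b) (q ^ 3) n / qpoch (q ^ 3 * a / b) (q ^ 3) n)"

definition G_factor :: "complex \<Rightarrow> complex \<Rightarrow> complex \<Rightarrow> complex" where
  "G_factor b q a = (1 - a * b\<^sup>2) * qpoch (a * q) q 3 / (qpoch (a * b) q 3 * (1 - q ^ 3 * a / b))"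

lemma G_Suc: "G b q (Suc n) a c = G b q n a c + G_summand b q a c n"
  by (simp add: G_def G_summand_def)

lemma G_0: "G b q 0 a c = 0"
  by (simp add: G_def)

text \<open>Both sides equal \<open>(1 - a * q ^ 3) * qpoch a q (n + 3)\<close>. This converts the
  factorial of the shifted sum into that of the original one.\<close>

lemma qpoch_shift3:
  "(1 - a) * (qpoch (a * q) q 3 * qpoch (a * q ^ 3) q n) =
    (1 - a * q ^ 3) * (qpoch a q n
      * ((1 - a * q ^ n) * (1 - a * q * q ^ n) * (1 - a * q ^ 2 * q ^ n)))"
proof -
  have "(1 - a) * qpoch (a * q) q 3 = qpoch a q (Suc 3)"
    by (rule qpoch_Suc_left [symmetric])
  also have "\<dots> = qpoch a q 3 * (1 - a * q ^ 3)"
    by (rule qpoch_Suc)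
  finally have "(1 - a) * (qpoch (a * q) q 3 * qpoch (a * q ^ 3) q n)
      = (1 - a * q ^ 3) * qpoch a q (3 + n)"
    by (simp add: qpoch_add mult_ac)
  also have "qpoch a q (3 + n) = qpoch a q n
      * ((1 - a * q ^ n) * (1 - a * q * q ^ n) * (1 - a * q ^ 2 * q ^ n))"
    by (simp add: eval_nat_numeral qpoch_Suc mult_ac)
  finally show ?thesis .
qed

text \<open>Each of the four terms is a common factor \<open>X\<close> times the matching term of
  \<open>contiguous_rat\<close> at \<open>Q = q ^ n\<close>. Writing \<open>n\<close> as
  \<open>Suc m\<close> gives access to the factorials of length \<open>n - 1\<close> in the boundary
  term.\<close>

lemma G_boundary_diff:
  fixes a b c q :: complex and m :: nat
  defines "n \<equiv> Suc m"
  assumes nz: "a \<noteq> 0" "b \<noteq> 0" "c \<noteq> 0" "q \<noteq> 0" "1 - a \<noteq> 0" "1 - a * q ^ 3 \<noteq> 0"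
    and E: "qpoch (a * q / c) q n \<noteq> 0" and F: "qpoch (c * q / (a * b)) q n \<noteq> 0"
    and H: "qpoch (q ^ 3) (q ^ 3) n \<noteq> 0" and M: "qpoch (q ^ 3 * a\<^sup>2 * b) (q ^ 3) n \<noteq> 0"
    and J: "qpoch (q ^ 3 * a / b) (q ^ 3) (Suc n) \<noteq> 0"
    and L: "qpoch (a * b) q (2 * n + 3) \<noteq> 0"
  shows "G_summand b q a c n - G_factor b q a * G_summand b q (a * q ^ 3) (c * q ^ 3) n
    = G_boundary b q a c (Suc n) - G_boundary b q a c n"
proof -
  define Q where "Q = q ^ n"
  have Q: "q ^ n = Q" "q ^ (2 * n) = Q ^ 2" "q ^ (4 * n) = Q ^ 4" "(q ^ 3) ^ n = Q ^ 3"
    by (simp_all add: Q_def power_mult [symmetric] mult.commute)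
  \<comment> \<open>The parameters \<open>a*q/c\<close>, \<open>c*q/(a*b)\<close>,
    \<open>q^3\<close> and \<open>q^3*a^2*b\<close> already carry one power of their base, so their
    last factors at length \<open>n\<close> are \<open>w1\<close> to \<open>w4\<close>, in terms of
    \<open>Q\<close> alone.\<close>
  have Qm: "q * q ^ m = Q" "q ^ 3 * (q ^ 3) ^ m = Q ^ 3"
    by (simp_all add: Q_def n_def power_mult_distrib power_mult [symmetric] mult.commute)
  define v where "v = 1 - q^3*a/b*Q^3"
  define u1 where "u1 = 1 - a*b*Q^2"
  define u2 where "u2 = 1 - a*b*q*Q^2"
  define u3 where "u3 = 1 - a*b*q^2*Q^2"
  define w1 where "w1 = 1 - a*Q/c"
  define w2 where "w2 = 1 - c*Q/(a*b)"
  define w3 where "w3 = 1 - Q^3"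
  define w4 where "w4 = 1 - a^2*b*Q^3"
  define x1 where "x1 = 1 - a"
  define y1 where "y1 = 1 - a*q^3"
  define x2 where "x2 = 1 - a*b"
  define z where "z = 1 - q^3*a/b"
  define s where "s = (1 - a*Q)*(1-a*q*Q)*(1-a*q^2*Q)"
  define e where "e = qpoch (a * q / c) q m"
  define f where "f = qpoch (c * q / (a * b)) q m"
  define h where "h = qpoch (q ^ 3) (q ^ 3) m"
  define g where "g = qpoch (q ^ 3 * a\<^sup>2 * b) (q ^ 3) m"
  define j where "j = qpoch (q ^ 3 * a / b) (q ^ 3) n"
  define l where "l = qpoch (a * b) q (2 * n)"
  define C where "C = qpoch (q ^ 3 * c) (q ^ 3) m"
  define D where "D = qpoch (q ^ 3 * a\<^sup>2 * b / c) (q ^ 3) m"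
  define A where "A = qpoch a q n"
  define B where "B = qpoch b q n"
  define P where "P = qpoch (q / b) q (2 * n)"
  define p3 where "p3 = qpoch (a * b) q 3"
  define a3 where "a3 = qpoch (a * q) q 3"
  define A' where "A' = qpoch (a * q ^ 3) q n"
  define l' where "l' = qpoch (a * b * q ^ 3) q (2 * n)"
  define j' where "j' = qpoch (q ^ 3 * a / b * q ^ 3) (q ^ 3) n"
  define k1 where "k1 = qpoch (q * a * b) q (2 * n)"
  define k2 where "k2 = qpoch (q * a * b) q (2 * Suc n)"
  have eE: "qpoch (a * q / c) q n = e * w1" "qpoch (q * a / c) q n = e * w1"
      "qpoch (q * a / c) q m = e"
    by (simp_all add: n_def qpoch_Suc e_def w1_def Qm [symmetric] mult_ac)
  have fF: "qpoch (c * q / (a * b)) q n = f * w2" "qpoch (q * c / (a * b)) q n = f * w2"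
      "qpoch (q * c / (a * b)) q m = f"
    by (simp_all add: n_def qpoch_Suc f_def w2_def Qm [symmetric] mult_ac)
  have hH: "qpoch (q ^ 3) (q ^ 3) n = h * w3"
    by (simp add: n_def qpoch_Suc h_def w3_def Qm(2) [symmetric])
  have gG: "qpoch (q ^ 3 * a\<^sup>2 * b) (q ^ 3) n = g * w4"
    by (simp add: n_def qpoch_Suc g_def w4_def Qm(2) [symmetric] mult_ac)
  have gG': "qpoch (q ^ 3 * a\<^sup>2 * b) (q ^ 3) (Suc n) = g * w4 * (1 - a^2*b*q^3*Q^3)"
    unfolding qpoch_Suc [of _ _ n] gG Q by (simp add: mult_ac)
  have jJ: "qpoch (q ^ 3 * a / b) (q ^ 3) (Suc n) = j * v"
    by (simp add: qpoch_Suc j_def v_def Q)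
  \<comment> \<open>A factorial with advanced parameter, preceded by its missing first factors, is a
    longer factorial with the original parameter; \<open>lL'\<close>, \<open>kK1\<close> and
    \<open>kK2\<close> use the same exchange.\<close>
  have jJ': "z * j' = j * v"
    using jJ by (simp add: qpoch_Suc_left j'_def z_def)
  have lL: "qpoch (a * b) q (2 * n + 3) = l * u1 * u2 * u3"
    unfolding l_def u1_def u2_def u3_def Q(2) [symmetric]
    by (simp add: eval_nat_numeral qpoch_Suc mult_ac)
  have lL': "p3 * l' = l * u1 * u2 * u3"
    unfolding lL [symmetric] p3_def l'_def by (simp add: qpoch_add [symmetric] add.commute)
  have kK1: "x2 * k1 = l * u1"
    using qpoch_Suc_left [of "a * b" q "2 * n"]
    unfolding qpoch_Suc k1_def x2_def l_def u1_def Q by (simp add: mult_ac)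
  have kK2: "x2 * k2 = l * u1 * u2 * u3"
    unfolding lL [symmetric] using qpoch_Suc_left [of "a * b" q "2 * Suc n"]
    by (simp add: k2_def x2_def mult_ac eval_nat_numeral)
  have aA: "x1 * (a3 * A') = y1 * (A * s)"
    unfolding x1_def a3_def A'_def y1_def A_def s_def Q(1) [symmetric] by (rule qpoch_shift3)
  have cC: "qpoch c (q ^ 3) n = (1 - c) * C"
    by (simp add: n_def qpoch_Suc_left C_def mult.commute)
  have dD: "qpoch (a\<^sup>2 * b / c) (q ^ 3) n = (1 - a^2*b/c) * D"
    by (simp add: n_def qpoch_Suc_left D_def mult_ac)
  have cC': "qpoch (q ^ 3 * c) (q ^ 3) n = C * (1 - c*Q^3)"
    by (simp add: n_def qpoch_Suc C_def Qm(2) [symmetric] mult_ac)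
  have dD': "qpoch (q ^ 3 * a\<^sup>2 * b / c) (q ^ 3) n = D * (1 - a^2*b/c*Q^3)"
    by (simp add: n_def qpoch_Suc D_def Qm(2) [symmetric] mult_ac)
  have pP: "qpoch (q / b) q (2 * Suc n) = P * (1-q/b*Q^2) * (1-q^2/b*Q^2)"
    unfolding P_def Q(2) [symmetric] by (simp add: qpoch_Suc mult_ac power2_eq_square)
  \<comment> \<open>Replacing \<open>a\<close>, \<open>c\<close> by \<open>a*q^3\<close>,
    \<open>c*q^3\<close> fixes \<open>a*q/c\<close> and \<open>c*q/(a*b)\<close> and advances the
    other parameters by \<open>q^3\<close>: one step in base \<open>q^3\<close>, three in base
    \<open>q\<close>.\<close>
  have shift: "a * q ^ 3 * q / (q ^ 3 * c) = a * q / c"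
      "q ^ 3 * c * q / (a * b * q ^ 3) = c * q / (a * b)"
      "(a * q ^ 3)\<^sup>2 * b / (q ^ 3 * c) = q ^ 3 * a\<^sup>2 * b / c"
      "q ^ 3 * (a * q ^ 3) / b = q ^ 3 * a / b * q ^ 3" "c * q ^ 3 = q ^ 3 * c"
      "a * q ^ 3 * b = a * b * q ^ 3"
    using nz by (simp_all add: field_simps power2_eq_square)
  have nzs: "e \<noteq> 0" "w1 \<noteq> 0" "f \<noteq> 0" "w2 \<noteq> 0" "h \<noteq> 0" "w3 \<noteq> 0" "g \<noteq> 0" "w4 \<noteq> 0"
      "j \<noteq> 0" "v \<noteq> 0" "l \<noteq> 0" "u1 \<noteq> 0" "u2 \<noteq> 0" "u3 \<noteq> 0" "x1 \<noteq> 0" "y1 \<noteq> 0"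
    using E F H M J L nz by (auto simp: eE fF hH gG jJ lL x1_def y1_def)
  have nzs': "z \<noteq> 0" "j' \<noteq> 0" "p3 \<noteq> 0" "l' \<noteq> 0" "x2 \<noteq> 0" "k1 \<noteq> 0" "k2 \<noteq> 0"
    using nzs jJ' lL' kK1 kK2 by auto
  \<comment> \<open>The numerator takes the shortest factorials occurring in the four terms, the
    denominator the longest, so each term is a polynomial in the split-off factors times
    \<open>X\<close>.\<close>
  define X where "X = A * B * C * D * P / (x1 * (e * w1) * (f * w2) * (h * w3) * (j * v) * (l * u1 * u2 * u3))"
  have t: "G_summand b q a c n = X * ((a*Q^4-1)*Q*(1-c)*(1-a^2*b/c)*v*u1*u2*u3)"
    unfolding G_summand_def qpochs_pair Q eE fF hH j_def [symmetric] l_def [symmetric]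
      A_def [symmetric] B_def [symmetric] P_def [symmetric] cC dD x1_def [symmetric] X_def
    using nzs by (simp add: divide_simps)
  have t': "G_factor b q a * G_summand b q (a * q ^ 3) (c * q ^ 3) n
      = X * ((1-a*b^2)*(a*q^3*Q^4-1)*Q*s*(1-c*Q^3)*(1-a^2*b/c*Q^3))"
  proof -
    have "G_factor b q a * G_summand b q (a * q ^ 3) (c * q ^ 3) n
      = (1-a*b^2)*(a*q^3*Q^4-1)*Q*(a3*A'/y1)*B*C*D*P*(1-c*Q^3)*(1-a^2*b/c*Q^3)
        / ((e*w1)*(f*w2)*(h*w3)*(z*j')*(p3*l'))"
      unfolding G_factor_def G_summand_def qpochs_pair shift Q eE fF hH j'_def [symmetric]
        l'_def [symmetric] p3_def [symmetric] a3_def [symmetric] z_def [symmetric]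
        A'_def [symmetric] B_def [symmetric] P_def [symmetric] cC' dD' y1_def [symmetric]
      by (simp add: mult_ac)
    also have "a3*A'/y1 = A*s/x1"
      using aA nzs by (simp add: divide_simps mult_ac)
    finally show ?thesis
      unfolding X_def jJ' lL' by (simp add: mult_ac)
  qed
  \<comment> \<open>The factorials of \<open>q^3*a^2*b\<close> above and below differ in length by
    one, so only \<open>w4\<close> survives here, and only the next factor in
    \<open>r'\<close>.\<close>
  have r: "G_boundary b q a c n = X * (a*b*w1*w2*w3*v*u2*u3*w4)"
  proof -
    have "G_boundary b q a c n = a*b*A*B*C*D*P*(w4*(g/g)) / (x1*(x2*k1)*e*f*h*j)"
      unfolding G_boundary_def qpochs_pair n_def diff_Suc_1
      unfolding n_def [symmetric] eE fF gG k1_def [symmetric]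
        h_def [symmetric] g_def [symmetric] C_def [symmetric] D_def [symmetric]
        j_def [symmetric] x1_def [symmetric] x2_def [symmetric] A_def [symmetric] B_def [symmetric]
        P_def [symmetric]
      by (simp add: mult_ac)
    then show ?thesis
      unfolding kK1 X_def using nzs by (simp add: divide_simps mult_ac)
  qed
  have r': "G_boundary b q a c (Suc n) = X * (a*b*(1-a*Q)*(1-b*Q)*(1-c*Q^3)*(1-a^2*b/c*Q^3)
      *(1-q/b*Q^2)*(1-q^2/b*Q^2)*(1-a^2*b*q^3*Q^3))"
  proof -
    have "G_boundary b q a c (Suc n) = a*b*(A*(1-a*Q))*(B*(1-b*Q))*(C*(1-c*Q^3))*(D*(1-a^2*b/c*Q^3))
        *(P*(1-q/b*Q^2)*(1-q^2/b*Q^2))*((g*w4/(g*w4))*(1-a^2*b*q^3*Q^3))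
        / (x1*(x2*k2)*(e*w1)*(f*w2)*(h*w3)*(j*v))"
      unfolding G_boundary_def qpochs_pair diff_Suc_1 pP gG' jJ qpoch_Suc [of a] qpoch_Suc [of b]
        eE fF gG k2_def [symmetric] cC' dD' hH Q
        x1_def [symmetric] x2_def [symmetric] A_def [symmetric] B_def [symmetric]
      by (simp add: mult_ac)
    then show ?thesis
      unfolding kK2 X_def using nzs by (simp add: mult_ac)
  qed
  show ?thesis
    unfolding t t' r r' right_diff_distrib [symmetric] v_def u1_def u2_def u3_def s_def
      w1_def w2_def w3_def w4_def
    using contiguous_rat [OF nz(1-3), of Q q] by (simp add: mult_ac)
qed

text \<open>Both summands are -1 at index 0, so the claim is \<open>K - 1 = R\<^sub>1\<close>, free
  of \<open>c\<close>. Setting \<open>Q = 1\<close> in \<open>contiguous_rat\<close> leaves a factor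
  \<open>(1-c)*(1-a^2*b/c)\<close> that may vanish, hence the separate argument.\<close>

lemma G_boundary_1:
  fixes a b c q :: complex
  assumes nz: "a \<noteq> 0" "b \<noteq> 0" "c \<noteq> 0" "1 - a \<noteq> 0" "1 - a * q ^ 3 \<noteq> 0"
    and p: "qpoch (a * b) q 3 * (1 - q ^ 3 * a / b) \<noteq> 0"
  shows "G_summand b q a c 0 - G_factor b q a * G_summand b q (a * q ^ 3) (c * q ^ 3) 0
    = G_boundary b q a c 1"
proof -
  define v where "v = b - q^3*a"
  define u1 where "u1 = 1 - a*b"
  define u2 where "u2 = 1 - a*b*q"
  define u3 where "u3 = 1 - a*b*q^2"
  have v: "1 - q^3*a/b = v/b"
    using nz by (simp add: v_def divide_simps)
  have u: "qpoch (a * b) q 3 = u1*u2*u3" "qpoch (q * a * b) q 2 = u2*u3"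
    by (simp_all add: u1_def u2_def u3_def qpoch_Suc eval_nat_numeral mult_ac)
  have n: "v \<noteq> 0" "u1 \<noteq> 0" "u2 \<noteq> 0" "u3 \<noteq> 0"
    using p unfolding v u by auto
  have s0: "G_summand b q a c 0 = - 1" "G_summand b q (a * q ^ 3) (c * q ^ 3) 0 = - 1"
    using nz by (simp_all add: G_summand_def divide_simps)
  have f: "G_factor b q a = b*(1-a*b^2)*(1-a*q)*(1-a*q^2)*(1-a*q^3) / (u1*u2*u3*v)"
    unfolding G_factor_def u v by (simp add: qpoch_Suc eval_nat_numeral mult_ac)
  have qb: "qpoch (q / b) q 2 = (b - q) * (b - q^2) / b^2"
    using nz by (simp add: qpoch_Suc eval_nat_numeral divide_simps)
  have r: "G_boundary b q a c 1 = a*(1-b)*(b-q)*(b-q^2)*(1-a^2*b*q^3) / (u1*u2*u3*v)"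
  proof -
    have "G_boundary b q a c 1 = a*b/((1-a)*u1)*((1-a)*(1-b))*((b-q)*(b-q^2)/b^2/(u2*u3))
        *((1-a^2*b*q^3)/(v/b))"
      unfolding G_boundary_def One_nat_def qpochs_pair qpoch_Suc [of _ _ 0]
      using v u(2) by (simp add: qb u1_def mult_ac flip: numeral_2_eq_2)
    then show ?thesis
      using nz n by (simp add: power2_eq_square mult_ac)
  qed
  \<comment> \<open>This is the relation \<open>A1 - Q^3 * A2 = Q^3 * A3 - Q * A4\<close> from
    \<open>contiguous_poly\<close> at \<open>Q = 1\<close>, where \<open>A4\<close>
    vanishes.\<close>
  have "(1-a)*(-(v*u1*u2*u3)+b*(1-a*b^2)*(1-a*q)*(1-a*q^2)*(1-a*q^3))
      = (1-a)*(a*(1-b)*(b-q)*(b-q^2)*(1-a^2*b*q^3))"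
    unfolding v_def u1_def u2_def u3_def by algebra
  then have *: "b*(1-a*b^2)*(1-a*q)*(1-a*q^2)*(1-a*q^3) - u1*u2*u3*v
      = a*(1-b)*(b-q)*(b-q^2)*(1-a^2*b*q^3)"
    using nz(4) by (simp add: mult_ac)
  show ?thesis
    unfolding s0 f r * [symmetric] diff_divide_distrib using n by simp
qed

theorem theorem3p14:
  fixes a b c q :: complex and n :: nat
  assumes "b \<noteq> 0" and "q \<noteq> 0" and "a \<noteq> 0" and "c \<noteq> 0" and "n \<ge> 1"
    and "G_denoms_nonzero b q n a c"
    and "G_denoms_nonzero b q n (a * q ^ 3) (c * q ^ 3)"
    and "qpoch (a * b) q 3 * (1 - q ^ 3 * a / b) \<noteq> 0"
    and "(1 - a) * (1 - a * b) \<noteq> 0"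
    and "qpochs [q * a / c, q * c / (a * b)] q (n - 1) \<noteq> 0"
    and "qpochs [q ^ 3, q ^ 3 * a\<^sup>2 * b] (q ^ 3) (n - 1) \<noteq> 0"
    and "qpoch (q * a * b) q (2 * n) \<noteq> 0"
    and "qpoch (q ^ 3 * a / b) (q ^ 3) n \<noteq> 0"
  shows "G b q n a c =
      (1 - a * b\<^sup>2) * qpoch (a * q) q 3 / (qpoch (a * b) q 3 * (1 - q ^ 3 * a / b))
        * G b q n (a * q ^ 3) (c * q ^ 3)
    + a * b / ((1 - a) * (1 - a * b))
        * (qpochs [a, b] q n / qpochs [q * a / c, q * c / (a * b)] q (n - 1))
        * (qpochs [q ^ 3 * c, q ^ 3 * a\<^sup>2 * b / c] (q ^ 3) (n - 1)
            / qpochs [q ^ 3, q ^ 3 * a\<^sup>2 * b] (q ^ 3) (n - 1))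
        * (qpoch (q / b) q (2 * n) / qpoch (q * a * b) q (2 * n))
        * (qpoch (q ^ 3 * a\<^sup>2 * b) (q ^ 3) n / qpoch (q ^ 3 * a / b) (q ^ 3) n)"
proof -
  \<comment> \<open>The induction stays below the fixed \<open>n\<close>, so that nonvanishing at
    length \<open>n\<close> passes to the shorter factorials.\<close>
  have recurrence: "G b q m a c = G_factor b q a * G b q m (a * q ^ 3) (c * q ^ 3)
      + G_boundary b q a c m" if "1 \<le> m" "m \<le> n" for m
    using that
  proof (induction m rule: nat_induct_at_least)
    case base
    then show ?case
      using G_boundary_1 [of a b c q] assms
      by (simp add: G_Suc G_0 G_denoms_nonzero_def algebra_simps)
  next
    case (Suc m)
    then obtain k where k: "m = Suc k"
      by (cases m) auto
    have m: "m < n" "m \<le> n - 1"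
      using Suc by auto
    \<comment> \<open>The denominators of the sum reach only length \<open>2 * (n - 1)\<close>. The
      factor \<open>1 - a * b\<close> and the boundary denominator give length
      \<open>2 * n + 1\<close>, which covers \<open>2 * m + 3\<close> since
      \<open>m < n\<close>.\<close>
    have "qpoch (a * b) q (Suc (2 * n)) \<noteq> 0"
      using assms(9,12) by (simp add: qpoch_Suc_left mult_ac)
    then have "qpoch (a * b) q (2 * m + 3) \<noteq> 0"
      using m by (elim qpoch_nonzero_mono) simp
    moreover have "qpoch (a * q / c) q m \<noteq> 0" "qpoch (c * q / (a * b)) q m \<noteq> 0"
        "qpoch (q ^ 3) (q ^ 3) m \<noteq> 0"
      using assms(6) m by (auto simp: G_denoms_nonzero_def)
    moreover have "qpoch (q ^ 3 * a\<^sup>2 * b) (q ^ 3) m \<noteq> 0"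
      using assms(11) m(2) qpoch_nonzero_mono [of _ _ "n - 1" m] by simp
    moreover have "qpoch (q ^ 3 * a / b) (q ^ 3) (Suc m) \<noteq> 0"
      using assms(13) m(1) qpoch_nonzero_mono [of _ _ n "Suc m"] by simp
    ultimately have "G_summand b q a c m - G_factor b q a * G_summand b q (a * q ^ 3) (c * q ^ 3) m
        = G_boundary b q a c (Suc m) - G_boundary b q a c m"
      unfolding k using assms(1-7)
      by (intro G_boundary_diff) (auto simp: G_denoms_nonzero_def)
    moreover have "G b q m a c = G_factor b q a * G b q m (a * q ^ 3) (c * q ^ 3)
        + G_boundary b q a c m"
      using Suc by simp
    ultimately show ?case
      by (simp add: G_Suc algebra_simps)
  qed
  show ?thesis
    using recurrence [OF \<open>n \<ge> 1\<close> order_refl] unfolding G_factor_def G_boundary_def .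
qed

end
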